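(* Let $(u_n)_{n\ge0}$ be a sequence of fuzzy numbers and let $\mu$ be a fuzzy number. If $(u_n)$ is Cesàro summable to $\mu$, then $(u_n)$ is Abel summable to $\mu$.
   Context: A fuzzy number is a function $u:\mathbb{R}\to[0,1]$ that is normal ($u(t_0)=1$ for some $t_0$), fuzzy convex ($u(\lambda s+(1-\lambda)t)\ge\min\{u(s),u(t)\}$ for $s,t\in\mathbb{R}$, $\lambda\in[0,1]$), upper semicontinuous, and has compact support $\overline{\{t:u(t)>0\}}$. The set of fuzzy numbers is $E^1$. For $u\in E^1$ the $\alpha$-level set is $[u]_\alpha=\{t:u(t)\ge\alpha\}$ for $0<\alpha\le1$ and $[u]_0=\overline{\{t:u(t)>0\}}$; it is a compact interval, written $[u]_\alpha=[u^-_\alpha,u^+_\alpha]$. Addition and scalar multiplication ($k\in\mathbb{R}$) are defined by $[u+v]_\alpha=[u^-_\alpha+v^-_\alpha,\,u^+_\alpha+v^+_\alpha]$ and $[ku]_\alpha=k[u]_\alpha$ for all $\alpha\in[0,1]$; $uk$ also denotes $ku$. The metric on $E^1$ is $D(u,v)=\sup_{\alpha\in[0,1]}\max\{|u^-_\alpha-v^-_\alpha|,|u^+_\alpha-v^+_\alpha|\}$; convergence and limits in $E^1$ are with respect to $D$. A series $\sum_{n=0}^\infty u_n$ of fuzzy numbers converges to $u\in E^1$ if its partial sums $\sum_{k=0}^n u_k$ converge to $u$. A sequence $(u_n)_{n\ge0}$ of fuzzy numbers is Cesàro summable to $\mu\in E^1$ if $\sigma_n=\frac{1}{n+1}\sum_{k=0}^n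 u_k$ converges to $\mu$. It is Abel summable to $\mu$ if the series $\sum_{n=0}^\infty u_nx^n$ converges for all $x\in(0,1)$ and $\lim_{x\to1^-}(1-x)\sum_{n=0}^\infty u_nx^n=\mu$. *)

theory Defs
  imports "HOL-Analysis.Analysis"
begin

section \<open>Fuzzy numbers and their level sets\<close>

text \<open>
  The five conjuncts: values in \<open>[0,1]\<close>, normality, fuzzy convexity, upper semicontinuity,
  compact support.
\<close>

definition is_fuzzy_number :: "(real \<Rightarrow> real) \<Rightarrow> bool" where
  "is_fuzzy_number u \<longleftrightarrow>
     (\<forall>t. 0 \<le> u t \<and> u t \<le> 1) \<and>
     (\<exists>t. u t = 1) \<and>
     (\<forall>s t. \<forall>l\<in>{0..1}. u (l * s + (1 - l) * t) \<ge> min (u s) (u t)) \<and>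
     (\<forall>t y. u t < y \<longrightarrow> (\<forall>\<^sub>F s in nhds t. u s < y)) \<and>
     compact (closure {t. u t > 0})"

lemma is_fuzzy_number_crisp: "is_fuzzy_number (\<lambda>t. if t = c then 1 else 0)"
proof -
  have "\<forall>\<^sub>F s in nhds t. (if s = c then 1 else 0) < y"
    if "(if t = c then 1 else 0) < y" for t y :: real
  proof (cases "t = c")
    case True
    then show ?thesis using that by (intro always_eventually) auto
  next
    case False
    then have "\<forall>\<^sub>F s in nhds t. s \<noteq> c" by (rule t1_space_nhds)
    then show ?thesis by (rule eventually_mono) (use that False in auto)
  qed
  moreover have "{t. (if t = c then 1 else 0::real) > 0} = {c}" by auto
  ultimately show ?thesis
    unfolding is_fuzzy_number_def by (auto simp: min_def algebra_simps)
qed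

typedef fuzzy_number = "{u. is_fuzzy_number u}"
  morphisms membership Abs_fuzzy_number
  using is_fuzzy_number_crisp by blast

text \<open>Only levels \<open>\<alpha> \<in> [0,1]\<close> are meaningful.\<close>

definition level :: "fuzzy_number \<Rightarrow> real \<Rightarrow> real set" where
  "level u \<alpha> = (if \<alpha> = 0 then closure {t. membership u t > 0} else {t. membership u t \<ge> \<alpha>})"

definition lower :: "fuzzy_number \<Rightarrow> real \<Rightarrow> real" where
  "lower u \<alpha> = Inf (level u \<alpha>)"

definition upper :: "fuzzy_number \<Rightarrow> real \<Rightarrow> real" where
  "upper u \<alpha> = Sup (level u \<alpha>)"

lemma membership_props:
  shows membership_ge_0: "0 \<le> membership u t"
    and membership_le_1: "membership u t \<le> 1"
    and membership_normal: "\<exists>t. membership u t = 1"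
    and membership_convex:
      "l \<in> {0..1} \<Longrightarrow> membership u (l * s + (1 - l) * t) \<ge> min (membership u s) (membership u t)"
    and membership_usc: "membership u t < y \<Longrightarrow> \<forall>\<^sub>F s in nhds t. membership u s < y"
    and membership_compact: "compact (closure {t. membership u t > 0})"
  using membership[of u] unfolding is_fuzzy_number_def by simp_all

lemma membership_between:
  assumes "a \<le> t" "t \<le> b"
  shows "membership u t \<ge> min (membership u a) (membership u b)"
proof (cases "a = b")
  case True
  then show ?thesis using assms by auto
next
  case False
  define l where "l = (b - t) / (b - a)"
  have "l \<in> {0..1}" using assms False by (auto simp: l_def field_simps)
  moreover have "l * (b - a) = b - t" using False by (simp add: l_def)
  then have "l * a + (1 - l) * b = t" by (simp add: algebra_simps)
  ultimately show ?thesis using membership_convex[of l u a b] by simp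
qed

lemma is_interval_support: "is_interval {t. membership u t > 0}"
  unfolding is_interval_1 using membership_between[of _ _ _ u]
  by (smt (verit) mem_Collect_eq min_def)

lemma level_subset_0: "0 \<le> \<alpha> \<Longrightarrow> level u \<alpha> \<subseteq> level u 0"
  using closure_subset[of "{t. membership u t > 0}"] by (auto simp: level_def)

lemma level_antimono:
  assumes "0 \<le> \<alpha>" "\<alpha> \<le> \<beta>"
  shows "level u \<beta> \<subseteq> level u \<alpha>"
  using assms level_subset_0[of \<beta> u] by (cases "\<alpha> = 0") (auto simp: level_def)

lemma closed_level: "closed (level u \<alpha>)"
proof (cases "\<alpha> = 0")
  case False
  have "open {t. membership u t < \<alpha>}"
    unfolding open_subopen[of "{t. membership u t < \<alpha>}"]
    using membership_usc[of u _ \<alpha>] by (auto simp: eventually_nhds subset_eq)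
  then have "closed (- {t. membership u t < \<alpha>})" by (rule closed_Compl)
  also have "- {t. membership u t < \<alpha>} = level u \<alpha>" using False by (auto simp: level_def)
  finally show ?thesis .
qed (simp add: level_def)

lemma compact_level:
  assumes "0 \<le> \<alpha>"
  shows "compact (level u \<alpha>)"
proof -
  have "compact (level u 0 \<inter> level u \<alpha>)"
    using membership_compact[of u] closed_level[of u \<alpha>]
    by (intro compact_Int_closed) (auto simp: level_def)
  also have "level u 0 \<inter> level u \<alpha> = level u \<alpha>" using level_subset_0[OF assms, of u] by auto
  finally show ?thesis .
qed

lemma level_nonempty:
  assumes "0 \<le> \<alpha>" "\<alpha> \<le> 1"
  shows "level u \<alpha> \<noteq> {}"
proof -
  obtain t where "membership u t = 1" using membership_normal by blast
  then have "t \<in> level u 1" by (simp add: level_def)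
  then show ?thesis using level_antimono[OF assms, of u] by auto
qed

lemma is_interval_level: "is_interval (level u \<alpha>)"
proof (cases "\<alpha> = 0")
  case True
  then show ?thesis
    using is_interval_support[of u] convex_closure[of "{t. membership u t > 0}"]
    by (simp add: level_def is_interval_convex_1)
next
  case False
  then show ?thesis unfolding is_interval_1 level_def
    using membership_between[of _ _ _ u] by (smt (verit) mem_Collect_eq min_def)
qed

lemma level_eq_Icc:
  assumes "0 \<le> \<alpha>" "\<alpha> \<le> 1"
  shows "level u \<alpha> = {lower u \<alpha>..upper u \<alpha>}" and "lower u \<alpha> \<le> upper u \<alpha>"
proof -
  have "connected (level u \<alpha>)" using is_interval_level[of u \<alpha>] by (simp add: is_interval_connected_1)
  then obtain a b where ab: "level u \<alpha> = {a..b}"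
    using compact_level[OF assms(1), of u] connected_compact_interval_1 by blast
  then have "a \<le> b" using level_nonempty[OF assms, of u] by auto
  then show "level u \<alpha> = {lower u \<alpha>..upper u \<alpha>}" "lower u \<alpha> \<le> upper u \<alpha>"
    using ab by (auto simp: lower_def upper_def)
qed

lemma lower_mono:
  assumes "0 \<le> \<alpha>" "\<alpha> \<le> \<beta>" "\<beta> \<le> 1"
  shows "lower u \<alpha> \<le> lower u \<beta>" and "upper u \<beta> \<le> upper u \<alpha>"
  using level_antimono[OF assms(1,2), of u] level_eq_Icc[of \<alpha> u] level_eq_Icc[of \<beta> u] assms
  by auto

lemma level_bounds:
  assumes "0 \<le> \<alpha>" "\<alpha> \<le> 1"
  shows "lower u 0 \<le> lower u \<alpha>" "lower u \<alpha> \<le> upper u \<alpha>" "upper u \<alpha> \<le> upper u 0"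
  using lower_mono[of 0 \<alpha> u] level_eq_Icc(2)[OF assms, of u] assms by auto

lemma level_Inter:
  assumes "0 < \<alpha>" "\<And>\<beta>. 0 < \<beta> \<Longrightarrow> \<beta> < \<alpha> \<Longrightarrow> t \<in> level u \<beta>"
  shows "t \<in> level u \<alpha>"
proof -
  have "membership u t \<ge> \<alpha>"
  proof (rule ccontr)
    assume "\<not> ?thesis"
    then obtain \<beta> where "max 0 (membership u t) < \<beta>" "\<beta> < \<alpha>"
      using dense[of "max 0 (membership u t)" \<alpha>] assms(1) by auto
    then show False using assms(2)[of \<beta>] by (auto simp: level_def)
  qed
  then show ?thesis using assms(1) by (auto simp: level_def)
qed

lemma fuzzy_number_eqI_level:
  assumes "\<And>\<alpha>. 0 < \<alpha> \<Longrightarrow> \<alpha> \<le> 1 \<Longrightarrow> level u \<alpha> = level v \<alpha>"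
  shows "u = v"
proof -
  have le: "membership u t \<le> membership v t"
    if "\<And>\<alpha>. 0 < \<alpha> \<Longrightarrow> \<alpha> \<le> 1 \<Longrightarrow> level u \<alpha> = level v \<alpha>" for u v t
  proof (cases "membership u t = 0")
    case True
    then show ?thesis using membership_ge_0 by simp
  next
    case False
    then have *: "0 < membership u t" "membership u t \<le> 1"
      using membership_ge_0[of u t] membership_le_1[of u t] by auto
    then have "t \<in> level u (membership u t)" by (simp add: level_def)
    then have "t \<in> level v (membership u t)" using that * by blast
    then show ?thesis using * by (simp add: level_def)
  qed
  have "membership u = membership v"
    using le[of u v] le[of v u] assms by (intro ext antisym) auto
  then show ?thesis by (simp add: membership_inject)
qed

lemma fuzzy_number_eqI:
  assumes "\<And>\<alpha>. 0 \<le> \<alpha> \<Longrightarrow> \<alpha> \<le> 1 \<Longrightarrow> lower u \<alpha> = lower v \<alpha>"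
    and "\<And>\<alpha>. 0 \<le> \<alpha> \<Longrightarrow> \<alpha> \<le> 1 \<Longrightarrow> upper u \<alpha> = upper v \<alpha>"
  shows "u = v"
  by (rule fuzzy_number_eqI_level) (simp add: level_eq_Icc(1) assms)

section \<open>Fuzzy numbers from families of intervals\<close>

definition level_family :: "(real \<Rightarrow> real) \<Rightarrow> (real \<Rightarrow> real) \<Rightarrow> bool" where
  "level_family a b \<longleftrightarrow>
     (\<forall>\<alpha> \<beta>. 0 \<le> \<alpha> \<and> \<alpha> \<le> \<beta> \<and> \<beta> \<le> 1 \<longrightarrow> a \<alpha> \<le> a \<beta> \<and> b \<beta> \<le> b \<alpha>) \<and>
     a 1 \<le> b 1 \<and>
     (\<forall>\<alpha>. 0 < \<alpha> \<and> \<alpha> \<le> 1 \<longrightarrow> (a \<longlongrightarrow> a \<alpha>) (at_left \<alpha>) \<and> (b \<longlongrightarrow> b \<alpha>) (at_left \<alpha>)) \<and>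
     (a \<longlongrightarrow> a 0) (at_right 0) \<and> (b \<longlongrightarrow> b 0) (at_right 0)"

lemma eventually_at_left_01: "0 < (\<alpha>::real) \<Longrightarrow> \<forall>\<^sub>F \<beta> in at_left \<alpha>. 0 < \<beta> \<and> \<beta> < \<alpha>"
  unfolding eventually_at_left_field by (intro exI[of _ 0]) auto

lemma eventually_at_right_01: "\<forall>\<^sub>F \<beta> in at_right (0::real). 0 < \<beta> \<and> \<beta> < 1"
  unfolding eventually_at_right_field by (intro exI[of _ 1]) auto

lemma level_family_endpoints: "level_family (lower u) (upper u)"
proof -
  have left: "(lower u \<longlongrightarrow> lower u \<alpha>) (at_left \<alpha>) \<and> (upper u \<longlongrightarrow> upper u \<alpha>) (at_left \<alpha>)"
    if \<alpha>: "0 < \<alpha>" "\<alpha> \<le> 1" for \<alpha>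
  proof
    show "(lower u \<longlongrightarrow> lower u \<alpha>) (at_left \<alpha>)"
    proof (rule order_tendstoI)
      fix y assume y: "y < lower u \<alpha>"
      have "y \<notin> level u \<alpha>" using y \<alpha> by (simp add: level_eq_Icc)
      then obtain \<beta> where \<beta>: "0 < \<beta>" "\<beta> < \<alpha>" "y \<notin> level u \<beta>"
        using level_Inter[of \<alpha> y u] \<alpha> by blast
      moreover have "y \<le> upper u \<beta>"
        using y level_eq_Icc(2)[of \<alpha> u] lower_mono(2)[of \<beta> \<alpha> u] \<alpha> \<beta> by simp
      ultimately have "y < lower u \<beta>" using \<alpha> by (simp add: level_eq_Icc)
      then show "\<forall>\<^sub>F x in at_left \<alpha>. y < lower u x"
        unfolding eventually_at_left_field using \<alpha> \<beta> lower_mono(1)[of \<beta> _ u]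
        by (intro exI[of _ \<beta>]) (smt (verit))
    next
      fix y assume y: "lower u \<alpha> < y"
      show "\<forall>\<^sub>F x in at_left \<alpha>. lower u x < y"
        by (rule eventually_mono[OF eventually_at_left_01[OF \<alpha>(1)]])
          (use \<alpha> y lower_mono(1)[of _ \<alpha> u] in \<open>smt (verit)\<close>)
    qed
    show "(upper u \<longlongrightarrow> upper u \<alpha>) (at_left \<alpha>)"
    proof (rule order_tendstoI)
      fix y assume y: "upper u \<alpha> < y"
      have "y \<notin> level u \<alpha>" using y \<alpha> by (simp add: level_eq_Icc)
      then obtain \<beta> where \<beta>: "0 < \<beta>" "\<beta> < \<alpha>" "y \<notin> level u \<beta>"
        using level_Inter[of \<alpha> y u] \<alpha> by blast
      moreover have "y \<ge> lower u \<beta>"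
        using y level_eq_Icc(2)[of \<alpha> u] lower_mono(1)[of \<beta> \<alpha> u] \<alpha> \<beta> by simp
      ultimately have "upper u \<beta> < y" using \<alpha> by (simp add: level_eq_Icc)
      then show "\<forall>\<^sub>F x in at_left \<alpha>. upper u x < y"
        unfolding eventually_at_left_field using \<alpha> \<beta> lower_mono(2)[of \<beta> _ u]
        by (intro exI[of _ \<beta>]) (smt (verit))
    next
      fix y assume y: "y < upper u \<alpha>"
      show "\<forall>\<^sub>F x in at_left \<alpha>. y < upper u x"
        by (rule eventually_mono[OF eventually_at_left_01[OF \<alpha>(1)]])
          (use \<alpha> y lower_mono(2)[of _ \<alpha> u] in \<open>smt (verit)\<close>)
    qed
  qed
  have near: "\<exists>\<beta> s. 0 < \<beta> \<and> \<beta> \<le> 1 \<and> s \<in> level u \<beta> \<and> s \<in> S"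
    if t: "t \<in> level u 0" and S: "open S" "t \<in> S" for t S
  proof -
    have "t \<in> closure {t. membership u t > 0}" using t by (simp add: level_def)
    then obtain s where "s \<in> S" "membership u s > 0"
      using S unfolding closure_iff_nhds_not_empty by blast
    then show ?thesis using membership_le_1[of u s]
      by (intro exI[of _ "membership u s"] exI[of _ s]) (auto simp: level_def)
  qed
  have e0: "lower u 0 \<in> level u 0" "upper u 0 \<in> level u 0"
    using level_eq_Icc[of 0 u] by auto
  have "(lower u \<longlongrightarrow> lower u 0) (at_right 0)"
  proof (rule order_tendstoI)
    fix y assume y: "y < lower u 0"
    show "\<forall>\<^sub>F x in at_right 0. y < lower u x"
      by (rule eventually_mono[OF eventually_at_right_01])
        (use y lower_mono(1)[of 0 _ u] in \<open>smt (verit)\<close>)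
  next
    fix y assume y: "lower u 0 < y"
    obtain \<beta> s where \<beta>: "0 < \<beta>" "\<beta> \<le> 1" "s \<in> level u \<beta>" "s < y"
      using near[OF e0(1), of "{..<y}"] y by auto
    then have "lower u \<beta> < y" by (simp add: level_eq_Icc)
    then show "\<forall>\<^sub>F x in at_right 0. lower u x < y"
      unfolding eventually_at_right_field using \<beta> lower_mono(1)[of _ \<beta> u]
      by (intro exI[of _ \<beta>]) (smt (verit))
  qed
  moreover have "(upper u \<longlongrightarrow> upper u 0) (at_right 0)"
  proof (rule order_tendstoI)
    fix y assume y: "upper u 0 < y"
    show "\<forall>\<^sub>F x in at_right 0. upper u x < y"
      by (rule eventually_mono[OF eventually_at_right_01])
        (use y lower_mono(2)[of 0 _ u] in \<open>smt (verit)\<close>)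
  next
    fix y assume y: "y < upper u 0"
    obtain \<beta> s where \<beta>: "0 < \<beta>" "\<beta> \<le> 1" "s \<in> level u \<beta>" "y < s"
      using near[OF e0(2), of "{y<..}"] y by auto
    then have "y < upper u \<beta>" by (simp add: level_eq_Icc)
    then show "\<forall>\<^sub>F x in at_right 0. y < upper u x"
      unfolding eventually_at_right_field using \<beta> lower_mono(2)[of _ \<beta> u]
      by (intro exI[of _ \<beta>]) (smt (verit))
  qed
  ultimately show ?thesis
    unfolding level_family_def using left lower_mono[of _ _ u] level_eq_Icc(2)[of 1 u] by auto
qed

lemma fuzzy_number_of_level_family:
  assumes "level_family a b"
  shows "\<exists>w. \<forall>\<alpha>\<in>{0..1}. level w \<alpha> = {a \<alpha>..b \<alpha>}"
proof -
  have mono: "a \<alpha> \<le> a \<beta>" "b \<beta> \<le> b \<alpha>" if "0 \<le> \<alpha>" "\<alpha> \<le> \<beta>" "\<beta> \<le> 1" for \<alpha> \<beta>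
    using assms that unfolding level_family_def by blast+
  have one: "a 1 \<le> b 1" using assms unfolding level_family_def by blast
  have left: "(a \<longlongrightarrow> a \<alpha>) (at_left \<alpha>)" "(b \<longlongrightarrow> b \<alpha>) (at_left \<alpha>)"
    if "0 < \<alpha>" "\<alpha> \<le> 1" for \<alpha>
    using assms that unfolding level_family_def by blast+
  have right: "(a \<longlongrightarrow> a 0) (at_right 0)" "(b \<longlongrightarrow> b 0) (at_right 0)"
    using assms unfolding level_family_def by blast+
  define S where "S t = insert 0 {\<alpha>. 0 < \<alpha> \<and> \<alpha> \<le> 1 \<and> t \<in> {a \<alpha>..b \<alpha>}}" for t
  define w where "w t = Sup (S t)" for t
  have bdd: "bdd_above (S t)" for t unfolding S_def by (intro bdd_aboveI[of _ 1]) auto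
  have ne: "S t \<noteq> {}" for t unfolding S_def by auto
  have w01: "0 \<le> w t" "w t \<le> 1" for t
  proof -
    show "0 \<le> w t" unfolding w_def by (rule cSup_upper[OF _ bdd]) (simp add: S_def)
    show "w t \<le> 1" unfolding w_def by (rule cSup_least[OF ne]) (auto simp: S_def)
  qed
  have lev: "{t. w t \<ge> \<alpha>} = {a \<alpha>..b \<alpha>}" if \<alpha>: "0 < \<alpha>" "\<alpha> \<le> 1" for \<alpha>
  proof (intro equalityI subsetI)
    fix t assume "t \<in> {a \<alpha>..b \<alpha>}"
    then have "\<alpha> \<in> S t" using \<alpha> by (simp add: S_def)
    then show "t \<in> {t. w t \<ge> \<alpha>}" unfolding w_def using cSup_upper[OF _ bdd] by auto
  next
    fix t assume t: "t \<in> {t. w t \<ge> \<alpha>}"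
    have in_b: "a \<beta> \<le> t \<and> t \<le> b \<beta>" if \<beta>: "0 < \<beta>" "\<beta> < \<alpha>" for \<beta>
    proof -
      have "\<beta> < Sup (S t)" using t \<beta> unfolding w_def by simp
      then obtain \<gamma> where \<gamma>: "\<gamma> \<in> S t" "\<beta> < \<gamma>" using less_cSup_iff[OF ne bdd] by blast
      then have "\<gamma> \<le> 1" "a \<gamma> \<le> t" "t \<le> b \<gamma>" using \<beta> by (auto simp: S_def)
      then show ?thesis using mono[of \<beta> \<gamma>] \<beta> \<gamma> by simp
    qed
    have "a \<alpha> \<le> t"
      using eventually_at_left_01[OF \<alpha>(1)] in_b
      by (intro tendsto_upperbound[OF left(1)[OF \<alpha>]]) (auto elim!: eventually_mono)
    moreover have "t \<le> b \<alpha>"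
      using eventually_at_left_01[OF \<alpha>(1)] in_b
      by (intro tendsto_lowerbound[OF left(2)[OF \<alpha>]]) (auto elim!: eventually_mono)
    ultimately show "t \<in> {a \<alpha>..b \<alpha>}" by simp
  qed
  have ab: "a \<alpha> \<le> b \<alpha>" if "0 \<le> \<alpha>" "\<alpha> \<le> 1" for \<alpha>
    using mono[of \<alpha> 1] one that by simp
  have supp: "closure {t. w t > 0} = {a 0..b 0}"
  proof (rule antisym)
    have "{t. w t > 0} \<subseteq> {a 0..b 0}"
    proof
      fix t assume "t \<in> {t. w t > 0}"
      then have "w t > 0" by simp
      then have "t \<in> {a (w t)..b (w t)}" using lev[of "w t"] w01[of t] by blast
      then show "t \<in> {a 0..b 0}" using mono[of 0 "w t"] w01[of t] by auto
    qed
    then show "closure {t. w t > 0} \<subseteq> {a 0..b 0}" by (rule closure_minimal) simp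
  next
    have sub: "{a \<beta>..b \<beta>} \<subseteq> {t. w t > 0}" if "0 < \<beta>" "\<beta> < 1" for \<beta>
    proof
      fix t assume "t \<in> {a \<beta>..b \<beta>}"
      moreover have "{t. w t \<ge> \<beta>} = {a \<beta>..b \<beta>}" by (rule lev) (use that in simp_all)
      ultimately have "\<beta> \<le> w t" by blast
      then show "t \<in> {t. w t > 0}" using that by simp
    qed
    have cl: "x \<in> closure {t. w t > 0}"
      if "(f \<longlongrightarrow> x) (at_right 0)" "\<And>\<beta>. 0 < \<beta> \<Longrightarrow> \<beta> < 1 \<Longrightarrow> f \<beta> \<in> {a \<beta>..b \<beta>}" for f x
    proof (rule Lim_in_closed_set[OF closed_closure _ _ that(1)])
      show "\<forall>\<^sub>F \<beta> in at_right 0. f \<beta> \<in> closure {t. w t > 0}"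
        using eventually_at_right_01
      proof (rule eventually_mono)
        fix \<beta> :: real assume \<beta>: "0 < \<beta> \<and> \<beta> < 1"
        then have "f \<beta> \<in> {t. w t > 0}" using sub[of \<beta>] that(2)[of \<beta>] by blast
        then show "f \<beta> \<in> closure {t. w t > 0}" by (rule closure_subset[THEN subsetD])
      qed
    qed simp
    show "{a 0..b 0} \<subseteq> closure {t. w t > 0}"
    proof
      fix x assume x: "x \<in> {a 0..b 0}"
      have "((\<lambda>\<beta>. max (a \<beta>) (min x (b \<beta>))) \<longlongrightarrow> max (a 0) (min x (b 0))) (at_right 0)"
        by (intro tendsto_max tendsto_min right tendsto_const)
      moreover have "max (a 0) (min x (b 0)) = x" using x by auto
      moreover have "max (a \<beta>) (min x (b \<beta>)) \<in> {a \<beta>..b \<beta>}" if "0 < \<beta>" "\<beta> < 1" for \<beta>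
        using ab[of \<beta>] that by auto
      ultimately show "x \<in> closure {t. w t > 0}"
        using cl[of "\<lambda>\<beta>. max (a \<beta>) (min x (b \<beta>))" x] by simp
    qed
  qed
  have "is_fuzzy_number w"
    unfolding is_fuzzy_number_def
  proof (intro conjI allI ballI impI)
    show "0 \<le> w t" "w t \<le> 1" for t by (rule w01)+
    have "a 1 \<in> {t. w t \<ge> 1}" using lev[of 1] one by simp
    then show "\<exists>t. w t = 1" using w01(2)[of "a 1"] by (intro exI[of _ "a 1"]) simp
    show "compact (closure {t. w t > 0})" unfolding supp by simp
    show "min (w s) (w t) \<le> w (l * s + (1 - l) * t)" if l: "l \<in> {0..1}" for s t l
    proof (cases "min (w s) (w t) = 0")
      case True
      then show ?thesis using w01 by simp
    next
      case False
      define m where "m = min (w s) (w t)"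
      have m: "0 < m" "m \<le> 1" using False w01[of s] w01[of t] by (auto simp: m_def min_def)
      have "s \<in> {a m..b m}" "t \<in> {a m..b m}" unfolding lev[OF m, symmetric] by (auto simp: m_def)
      then have "l *\<^sub>R s + (1 - l) *\<^sub>R t \<in> {a m..b m}"
        using convex_real_interval(5)[of "a m" "b m"] l unfolding convex_def by auto
      then show ?thesis unfolding lev[OF m, symmetric] by (simp add: m_def)
    qed
    show "\<forall>\<^sub>F s in nhds t. w s < y" if y: "w t < y" for t y
    proof (cases "y > 1")
      case True
      then show ?thesis using w01(2) by (intro always_eventually allI) (meson le_less_trans)
    next
      case False
      have y': "0 < y" "y \<le> 1" using y False w01(1)[of t] by auto
      have "open (- {a y..b y})" by (simp add: open_Compl)
      moreover have "t \<in> - {a y..b y}" unfolding lev[OF y', symmetric] using y by simp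
      ultimately have "\<forall>\<^sub>F s in nhds t. s \<in> - {a y..b y}" by (rule eventually_nhds_in_open)
      then show ?thesis unfolding lev[OF y', symmetric] by (auto elim!: eventually_mono)
    qed
  qed
  then have mem: "membership (Abs_fuzzy_number w) = w" by (simp add: Abs_fuzzy_number_inverse)
  have "\<forall>\<alpha>\<in>{0..1}. level (Abs_fuzzy_number w) \<alpha> = {a \<alpha>..b \<alpha>}"
    using lev supp unfolding level_def mem by auto
  then show ?thesis by blast
qed

lemma fuzzy_number_of_level_family_ex1:
  assumes "level_family a b"
  shows "\<exists>!w. \<forall>\<alpha>\<in>{0..1}. level w \<alpha> = {a \<alpha>..b \<alpha>}"
  using fuzzy_number_of_level_family[OF assms]
  by (auto intro!: fuzzy_number_eqI_level)

section \<open>Algebraic operations\<close>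

text \<open>
  Sum and scalar multiple are specified by their level sets; lemmas \<open>level_plus\<close> and
  \<open>level_scaleR\<close> below show that the described fuzzy numbers exist (and are unique), so that the
  definite descriptions are well defined. The zero is the crisp number \<open>0\<close>, i.e. the value of
  the empty sum. Fuzzy numbers are not a vector space: there are no additive inverses, and
  \<open>(a + b) *\<^sub>R u = a *\<^sub>R u + b *\<^sub>R u\<close> fails for scalars of opposite sign.
\<close>

instantiation fuzzy_number :: "{zero, plus, scaleR}"
begin

definition zero_fuzzy_number :: fuzzy_number where
  "0 = Abs_fuzzy_number (\<lambda>t. if t = 0 then 1 else 0)"

definition plus_fuzzy_number :: "fuzzy_number \<Rightarrow> fuzzy_number \<Rightarrow> fuzzy_number" where
  "u + v = (THE w. \<forall>\<alpha>\<in>{0..1}. level w \<alpha> = {lower u \<alpha> + lower v \<alpha>..upper u \<alpha> + upper v \<alpha>})"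

definition scaleR_fuzzy_number :: "real \<Rightarrow> fuzzy_number \<Rightarrow> fuzzy_number" where
  "k *\<^sub>R u = (THE w. \<forall>\<alpha>\<in>{0..1}. level w \<alpha> = (\<lambda>t. k * t) ` level u \<alpha>)"

instance ..

end

lemma level_plus:
  assumes "0 \<le> \<alpha>" "\<alpha> \<le> 1"
  shows "level (u + v) \<alpha> = {lower u \<alpha> + lower v \<alpha>..upper u \<alpha> + upper v \<alpha>}"
proof -
  have "level_family (\<lambda>\<alpha>. lower u \<alpha> + lower v \<alpha>) (\<lambda>\<alpha>. upper u \<alpha> + upper v \<alpha>)"
    using level_family_endpoints[of u] level_family_endpoints[of v]
    unfolding level_family_def by (auto intro!: add_mono tendsto_add)
  from theI'[OF fuzzy_number_of_level_family_ex1[OF this]] show ?thesis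
    using assms unfolding plus_fuzzy_number_def by auto
qed

lemma level_scaleR:
  assumes "0 \<le> \<alpha>" "\<alpha> \<le> 1"
  shows "level (k *\<^sub>R u) \<alpha> = (\<lambda>t. k * t) ` level u \<alpha>"
proof -
  define a where "a = (\<lambda>\<alpha>. if k \<ge> 0 then k * lower u \<alpha> else k * upper u \<alpha>)"
  define b where "b = (\<lambda>\<alpha>. if k \<ge> 0 then k * upper u \<alpha> else k * lower u \<alpha>)"
  have img: "(\<lambda>t. k * t) ` level u \<alpha> = {a \<alpha>..b \<alpha>}" if "0 \<le> \<alpha>" "\<alpha> \<le> 1" for \<alpha>
    using level_eq_Icc[OF that, of u] by (auto simp: a_def b_def image_mult_atLeastAtMost_if)
  have "level_family a b"
  proof (cases "k \<ge> 0")
    case True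
    then have "a = (\<lambda>\<alpha>. k * lower u \<alpha>)" "b = (\<lambda>\<alpha>. k * upper u \<alpha>)" by (auto simp: a_def b_def)
    then show ?thesis using level_family_endpoints[of u] True
      unfolding level_family_def by (simp add: mult_left_mono tendsto_mult_left)
  next
    case False
    then have "a = (\<lambda>\<alpha>. k * upper u \<alpha>)" "b = (\<lambda>\<alpha>. k * lower u \<alpha>)" by (auto simp: a_def b_def)
    then show ?thesis using level_family_endpoints[of u] False
      unfolding level_family_def by (simp add: mult_left_mono_neg tendsto_mult_left)
  qed
  then have "\<exists>!w. \<forall>\<alpha>\<in>{0..1}. level w \<alpha> = {a \<alpha>..b \<alpha>}" by (rule fuzzy_number_of_level_family_ex1)
  moreover have "(\<forall>\<alpha>\<in>{0..1}. level w \<alpha> = {a \<alpha>..b \<alpha>}) \<longleftrightarrow>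
      (\<forall>\<alpha>\<in>{0..1}. level w \<alpha> = (\<lambda>t. k * t) ` level u \<alpha>)" for w
    using img by auto
  ultimately have "\<exists>!w. \<forall>\<alpha>\<in>{0..1}. level w \<alpha> = (\<lambda>t. k * t) ` level u \<alpha>" by simp
  from theI'[OF this] show ?thesis
    using assms unfolding scaleR_fuzzy_number_def by auto
qed

lemma endpoints_plus:
  assumes "0 \<le> \<alpha>" "\<alpha> \<le> 1"
  shows "lower (u + v) \<alpha> = lower u \<alpha> + lower v \<alpha>"
    and "upper (u + v) \<alpha> = upper u \<alpha> + upper v \<alpha>"
  using level_plus[OF assms, of u v] level_eq_Icc(2)[OF assms, of u] level_eq_Icc(2)[OF assms, of v]
  by (simp_all add: lower_def[of "u + v"] upper_def[of "u + v"])

lemma endpoints_scaleR: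
  assumes "0 \<le> \<alpha>" "\<alpha> \<le> 1" "0 \<le> k"
  shows "lower (k *\<^sub>R u) \<alpha> = k * lower u \<alpha>"
    and "upper (k *\<^sub>R u) \<alpha> = k * upper u \<alpha>"
  using level_scaleR[OF assms(1,2), of k u] level_eq_Icc[OF assms(1,2), of u] assms(3)
  by (auto simp: lower_def[of "k *\<^sub>R u"] upper_def[of "k *\<^sub>R u"] image_mult_atLeastAtMost_if
      mult_left_mono)

lemma endpoints_zero:
  assumes "0 \<le> \<alpha>" "\<alpha> \<le> 1"
  shows "lower 0 \<alpha> = 0" and "upper 0 \<alpha> = 0"
proof -
  have "membership 0 = (\<lambda>t. if t = 0 then 1 else 0)"
    unfolding zero_fuzzy_number_def by (simp add: Abs_fuzzy_number_inverse is_fuzzy_number_crisp)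
  moreover have "{t. (if t = 0 then 1 else 0::real) > 0} = {0::real}" by auto
  ultimately have "level 0 \<alpha> = {0}"
    using assms by (auto simp: level_def)
  then show "lower 0 \<alpha> = 0" "upper 0 \<alpha> = 0" by (simp_all add: lower_def upper_def)
qed

instance fuzzy_number :: comm_monoid_add
proof
  fix u v w :: fuzzy_number
  show "u + v + w = u + (v + w)"
    by (rule fuzzy_number_eqI) (simp_all add: endpoints_plus add.assoc)
  show "u + v = v + u"
    by (rule fuzzy_number_eqI) (simp_all add: endpoints_plus add.commute)
  show "0 + u = u"
    by (rule fuzzy_number_eqI) (simp_all add: endpoints_plus endpoints_zero)
qed

section \<open>The metric\<close>

instantiation fuzzy_number :: metric_space
begin

definition dist_fuzzy_number :: "fuzzy_number \<Rightarrow> fuzzy_number \<Rightarrow> real" where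
  "dist u v = (SUP \<alpha>\<in>{0..1}. max \<bar>lower u \<alpha> - lower v \<alpha>\<bar> \<bar>upper u \<alpha> - upper v \<alpha>\<bar>)"

definition uniformity_fuzzy_number :: "(fuzzy_number \<times> fuzzy_number) filter" where
  "uniformity = (INF e\<in>{0<..}. principal {(u::fuzzy_number, v). dist u v < e})"

definition open_fuzzy_number :: "fuzzy_number set \<Rightarrow> bool" where
  "open (U :: fuzzy_number set) \<longleftrightarrow> (\<forall>u\<in>U. \<forall>\<^sub>F (u', v) in uniformity. u' = u \<longrightarrow> v \<in> U)"

lemma bdd_above_dist_fuzzy_number:
  "bdd_above ((\<lambda>\<alpha>. max \<bar>lower u \<alpha> - lower v \<alpha>\<bar> \<bar>upper u \<alpha> - upper v \<alpha>\<bar>) ` {0..1})"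
proof (rule bdd_aboveI2)
  fix \<alpha> :: real assume "\<alpha> \<in> {0..1}"
  then show "max \<bar>lower u \<alpha> - lower v \<alpha>\<bar> \<bar>upper u \<alpha> - upper v \<alpha>\<bar>
      \<le> (upper u 0 - lower u 0) + (upper v 0 - lower v 0) + \<bar>lower u 0 - lower v 0\<bar>"
    using level_bounds[of \<alpha> u] level_bounds[of \<alpha> v] by auto
qed

lemma endpoint_le_dist_fuzzy_number:
  assumes "0 \<le> \<alpha>" "\<alpha> \<le> 1"
  shows "\<bar>lower u \<alpha> - lower v \<alpha>\<bar> \<le> dist u v" and "\<bar>upper u \<alpha> - upper v \<alpha>\<bar> \<le> dist u v"
  using cSUP_upper[OF _ bdd_above_dist_fuzzy_number, of \<alpha> u v] assms
  unfolding dist_fuzzy_number_def by auto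

lemma dist_fuzzy_number_le:
  assumes "\<And>\<alpha>. 0 \<le> \<alpha> \<Longrightarrow> \<alpha> \<le> 1 \<Longrightarrow> \<bar>lower u \<alpha> - lower v \<alpha>\<bar> \<le> c"
    and "\<And>\<alpha>. 0 \<le> \<alpha> \<Longrightarrow> \<alpha> \<le> 1 \<Longrightarrow> \<bar>upper u \<alpha> - upper v \<alpha>\<bar> \<le> c"
  shows "dist u v \<le> c"
  unfolding dist_fuzzy_number_def by (rule cSUP_least) (use assms in auto)

instance
proof
  fix u v w :: fuzzy_number
  show "(uniformity :: (fuzzy_number \<times> fuzzy_number) filter)
      = (INF e\<in>{0<..}. principal {(x, y). dist x y < e})"
    by (rule uniformity_fuzzy_number_def)
  show "open U \<longleftrightarrow> (\<forall>x\<in>U. \<forall>\<^sub>F (x', y) in uniformity. x' = x \<longrightarrow> y \<in> U)"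
    for U :: "fuzzy_number set"
    by (rule open_fuzzy_number_def)
  show "dist u v = 0 \<longleftrightarrow> u = v"
  proof
    assume "dist u v = 0"
    then show "u = v"
      using endpoint_le_dist_fuzzy_number[of _ u v] by (intro fuzzy_number_eqI) auto
  qed (simp add: dist_fuzzy_number_def)
  show "dist u v \<le> dist u w + dist v w"
    using endpoint_le_dist_fuzzy_number[of _ u w] endpoint_le_dist_fuzzy_number[of _ v w]
    by (intro dist_fuzzy_number_le) (smt (verit))+
qed

end

section \<open>Summability methods\<close>

definition cesaro_summable_to :: "(nat \<Rightarrow> fuzzy_number) \<Rightarrow> fuzzy_number \<Rightarrow> bool" where
  "cesaro_summable_to u \<mu> \<longleftrightarrow>
     (\<lambda>n. (1 / (real n + 1)) *\<^sub>R (\<Sum>k=0..n. u k)) \<longlonglongrightarrow> \<mu>"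

definition abel_summable_to :: "(nat \<Rightarrow> fuzzy_number) \<Rightarrow> fuzzy_number \<Rightarrow> bool" where
  "abel_summable_to u \<mu> \<longleftrightarrow>
     (\<forall>x\<in>{0<..<1::real}. summable (\<lambda>n. x ^ n *\<^sub>R u n)) \<and>
     ((\<lambda>x::real. (1 - x) *\<^sub>R (\<Sum>n. x ^ n *\<^sub>R u n)) \<longlongrightarrow> \<mu>) (at_left 1)"

end

theory Submission
  imports Defs
begin

text \<open>
  The argument transfers the classical Abelian theorem to fuzzy numbers through the endpoint
  functions of the level sets, and the point is to keep every estimate uniform in the level.
  Write \<open>\<sigma>\<^sub>n\<close> for the Cesaro means and \<open>d\<^sub>n = dist \<sigma>\<^sub>n \<mu>\<close>. At a fixed
  level, an endpoint of \<open>u\<^sub>n\<close> is a real sequence \<open>a\<^sub>n\<close> with means \<open>s\<^sub>n\<close>, and the corresponding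
  endpoint of \<open>\<mu>\<close> is some \<open>l\<close> with \<open>\<bar>s\<^sub>n - l\<bar> \<le> d\<^sub>n\<close>. Summation by parts gives
  \<open>\<Sum> a\<^sub>n x\<^sup>n = (1 - x) \<Sum> (n + 1) s\<^sub>n x\<^sup>n\<close>, and \<open>(1 - x)\<^sup>2 \<Sum> (n + 1) x\<^sup>n = 1\<close>, so
  \<open>\<bar>(1 - x) \<Sum> a\<^sub>n x\<^sup>n - l\<bar> \<le> (1 - x)\<^sup>2 \<Sum> (n + 1) d\<^sub>n x\<^sup>n\<close>
  (lemma \<open>abel_mean_bound\<close>). The right-hand side does not mention the level, hence it bounds the
  distance in the fuzzy metric; it is an average of the null sequence \<open>d\<^sub>n\<close> whose weights at each
  fixed index vanish as \<open>x\<close> tends to 1, so it tends to 0 (lemma \<open>weighted_mean_null\<close>).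

  Convergence of the fuzzy power series cannot be read off level by level, because pointwise
  limits of endpoint functions need not be the endpoints of a fuzzy number. It follows instead from
  completeness of the metric: uniform limits do preserve the one-sided continuity that
  characterises endpoint functions. With completeness, a series dominated by a convergent real
  series converges, and Cesaro summability makes \<open>u\<^sub>n\<close> grow at most linearly.
\<close>

section \<open>Completeness of the space of fuzzy numbers\<close>

lemma tendsto_endpoints:
  assumes "(X \<longlongrightarrow> w) F" "0 \<le> \<alpha>" "\<alpha> \<le> 1"
  shows "((\<lambda>n. lower (X n) \<alpha>) \<longlongrightarrow> lower w \<alpha>) F"
    and "((\<lambda>n. upper (X n) \<alpha>) \<longlongrightarrow> upper w \<alpha>) F"
proof -
  have "((\<lambda>n. dist (X n) w) \<longlongrightarrow> 0) F"
    using assms(1) by (rule tendsto_dist_iff[THEN iffD1])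
  then show "((\<lambda>n. lower (X n) \<alpha>) \<longlongrightarrow> lower w \<alpha>) F"
    and "((\<lambda>n. upper (X n) \<alpha>) \<longlongrightarrow> upper w \<alpha>) F"
    using endpoint_le_dist_fuzzy_number[OF assms(2,3), of _ w]
    by (auto intro: metric_tendsto_imp_tendsto simp: dist_real_def)
qed

text \<open>
  Monotonicity and order of the endpoints survive pointwise limits; uniformity is what allows the
  one-sided limits in the level to be exchanged with the limit along the sequence.
\<close>

lemma level_family_uniform_limit:
  fixes X :: "nat \<Rightarrow> fuzzy_number"
  assumes a: "uniform_limit {0..1} (\<lambda>n. lower (X n)) a sequentially"
    and b: "uniform_limit {0..1} (\<lambda>n. upper (X n)) b sequentially"
  shows "level_family a b"
proof -
  have pa: "(\<lambda>n. lower (X n) \<alpha>) \<longlonglongrightarrow> a \<alpha>" and pb: "(\<lambda>n. upper (X n) \<alpha>) \<longlonglongrightarrow> b \<alpha>"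
    if "0 \<le> \<alpha>" "\<alpha> \<le> 1" for \<alpha>
    using tendsto_uniform_limitI[OF a, of \<alpha>] tendsto_uniform_limitI[OF b, of \<alpha>] that by auto
  have lf: "level_family (lower (X n)) (upper (X n))" for n
    by (rule level_family_endpoints)
  have left_ev: "\<forall>\<^sub>F x in at_left \<alpha>. x \<in> {0..1}" if "0 < \<alpha>" "\<alpha> \<le> 1" for \<alpha> :: real
    by (rule eventually_mono[OF eventually_at_left_01[OF that(1)]]) (use that in auto)
  have right_ev: "\<forall>\<^sub>F x in at_right 0. x \<in> {0..1::real}"
    by (rule eventually_mono[OF eventually_at_right_01]) auto
  show ?thesis
    unfolding level_family_def
  proof (intro conjI allI impI; (elim conjE)?)
    fix \<alpha> \<beta> :: real assume "0 \<le> \<alpha>" "\<alpha> \<le> \<beta>" "\<beta> \<le> 1"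
    then show "a \<alpha> \<le> a \<beta>" "b \<beta> \<le> b \<alpha>"
      using lower_mono[of \<alpha> \<beta>] by (auto intro: LIMSEQ_le[OF pa pa] LIMSEQ_le[OF pb pb])
  next
    show "a 1 \<le> b 1"
      using level_eq_Icc(2)[of 1] by (auto intro: LIMSEQ_le[OF pa pb])
  next
    fix \<alpha> :: real assume \<alpha>: "0 < \<alpha>" "\<alpha> \<le> 1"
    show "(a \<longlongrightarrow> a \<alpha>) (at_left \<alpha>)"
      using lf \<alpha> by (intro swap_uniform_limit'[OF _ pa a left_ev]) (auto simp: level_family_def)
    show "(b \<longlongrightarrow> b \<alpha>) (at_left \<alpha>)"
      using lf \<alpha> by (intro swap_uniform_limit'[OF _ pb b left_ev]) (auto simp: level_family_def)
  next
    show "(a \<longlongrightarrow> a 0) (at_right 0)"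
      using lf by (intro swap_uniform_limit'[OF _ pa a right_ev]) (auto simp: level_family_def)
    show "(b \<longlongrightarrow> b 0) (at_right 0)"
      using lf by (intro swap_uniform_limit'[OF _ pb b right_ev]) (auto simp: level_family_def)
  qed
qed

instance fuzzy_number :: complete_space
proof
  fix X :: "nat \<Rightarrow> fuzzy_number"
  assume X: "Cauchy X"
  have close: "\<exists>M. \<forall>\<alpha>\<in>{0..1}. \<forall>m\<ge>M. \<forall>n\<ge>M.
      dist (lower (X m) \<alpha>) (lower (X n) \<alpha>) < e \<and> dist (upper (X m) \<alpha>) (upper (X n) \<alpha>) < e"
    if e: "e > 0" for e
  proof -
    obtain M where "\<forall>m\<ge>M. \<forall>n\<ge>M. dist (X m) (X n) < e"
      using X e unfolding Cauchy_def by blast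
    then show ?thesis
      using endpoint_le_dist_fuzzy_number unfolding dist_real_def
      by (intro exI[of _ M]) (meson atLeastAtMost_iff order.strict_trans1)
  qed
  have "uniformly_Cauchy_on {0..1} (\<lambda>n. lower (X n))"
    and "uniformly_Cauchy_on {0..1} (\<lambda>n. upper (X n))"
    using close by (auto intro!: uniformly_Cauchy_onI) meson+
  then obtain a b where a: "uniform_limit {0..1} (\<lambda>n. lower (X n)) a sequentially"
    and b: "uniform_limit {0..1} (\<lambda>n. upper (X n)) b sequentially"
    unfolding uniformly_convergent_eq_Cauchy[symmetric] uniformly_convergent_on_def by blast
  obtain w where w: "\<forall>\<alpha>\<in>{0..1}. level w \<alpha> = {a \<alpha>..b \<alpha>}"
    using fuzzy_number_of_level_family[OF level_family_uniform_limit[OF a b]] by blast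
  have ends: "lower w \<alpha> = a \<alpha>" "upper w \<alpha> = b \<alpha>" if "0 \<le> \<alpha>" "\<alpha> \<le> 1" for \<alpha>
    using w that level_nonempty[OF that, of w] by (auto simp: lower_def upper_def)
  have "X \<longlonglongrightarrow> w"
  proof (rule tendstoI)
    fix e :: real assume "e > 0"
    then have "e / 2 > 0" by simp
    from uniform_limitD[OF a this] uniform_limitD[OF b this]
    show "\<forall>\<^sub>F n in sequentially. dist (X n) w < e"
    proof eventually_elim
      case (elim n)
      then have "dist (X n) w \<le> e / 2"
        by (intro dist_fuzzy_number_le) (auto simp: ends dist_real_def less_imp_le)
      then show ?case using \<open>e > 0\<close> by simp
    qed
  qed
  then show "convergent X" by (auto simp: convergent_def)
qed

section \<open>Series of fuzzy numbers\<close>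

lemma dist_add_left_fuzzy_number: "dist (u + v) (u :: fuzzy_number) \<le> dist v 0"
  using endpoint_le_dist_fuzzy_number[of _ v 0]
  by (intro dist_fuzzy_number_le) (auto simp: endpoints_plus endpoints_zero)

lemma dist_scaleR_0_fuzzy_number:
  assumes "0 \<le> k"
  shows "dist (k *\<^sub>R u) (0 :: fuzzy_number) \<le> k * dist u 0"
  using endpoint_le_dist_fuzzy_number[of _ u 0] assms
  by (intro dist_fuzzy_number_le)
    (auto simp: endpoints_scaleR endpoints_zero abs_mult intro: mult_left_mono)

lemma dist_sum_0_fuzzy_number: "dist (sum v A) (0 :: fuzzy_number) \<le> (\<Sum>i\<in>A. dist (v i) 0)"
proof (induction A rule: infinite_finite_induct)
  case (insert i A)
  have "dist (v i + sum v A) 0 \<le> dist (v i + sum v A) (v i) + dist (v i) 0"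
    by (rule dist_triangle)
  also have "\<dots> \<le> dist (sum v A) 0 + dist (v i) 0"
    using dist_add_left_fuzzy_number[of "v i" "sum v A"] by simp
  finally show ?case using insert by simp
qed simp_all

lemma summable_fuzzy_number_comparison:
  fixes v :: "nat \<Rightarrow> fuzzy_number"
  assumes le: "\<And>n. dist (v n) 0 \<le> g n" and g: "summable g"
  shows "summable v"
proof -
  have block: "dist (sum v {..<n}) (sum v {..<m}) \<le> sum g {..<n} - sum g {..<m}"
    if "m \<le> n" for m n
  proof -
    have split: "sum f {..<n} = sum f {..<m} + sum f {m..<n}"
      for f :: "nat \<Rightarrow> 'a::comm_monoid_add"
      using sum.union_disjoint[of "{..<m}" "{m..<n}" f] that by (simp add: ivl_disj_un ivl_disj_int)
    have "dist (sum v {..<n}) (sum v {..<m}) \<le> dist (sum v {m..<n}) 0"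
      unfolding split[of v] by (rule dist_add_left_fuzzy_number)
    also have "\<dots> \<le> (\<Sum>i\<in>{m..<n}. dist (v i) 0)" by (rule dist_sum_0_fuzzy_number)
    also have "\<dots> \<le> sum g {m..<n}" by (rule sum_mono) (rule le)
    also have "\<dots> = sum g {..<n} - sum g {..<m}" using split[of g] by simp
    finally show ?thesis .
  qed
  have close: "dist (sum v {..<m}) (sum v {..<n}) \<le> dist (sum g {..<m}) (sum g {..<n})" for m n
    using block[of m n] block[of n m]
    by (cases "m \<le> n") (auto simp: dist_real_def dist_commute)
  have "Cauchy (\<lambda>n. sum g {..<n})"
    using g by (simp add: summable_iff_convergent convergent_Cauchy)
  then have "Cauchy (\<lambda>n. sum v {..<n})"
    unfolding Cauchy_def using close by (meson order.strict_trans1)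
  then show ?thesis
    by (simp add: summable_iff_convergent Cauchy_convergent_iff)
qed

lemma endpoints_sum:
  assumes "0 \<le> \<alpha>" "\<alpha> \<le> 1"
  shows "lower (sum v A) \<alpha> = (\<Sum>i\<in>A. lower (v i) \<alpha>)"
    and "upper (sum v A) \<alpha> = (\<Sum>i\<in>A. upper (v i) \<alpha>)"
  using assms
  by (induction A rule: infinite_finite_induct) (simp_all add: endpoints_plus endpoints_zero)

lemma sums_endpoints:
  assumes "v sums w" "0 \<le> \<alpha>" "\<alpha> \<le> 1"
  shows "(\<lambda>n. lower (v n) \<alpha>) sums lower w \<alpha>"
    and "(\<lambda>n. upper (v n) \<alpha>) sums upper w \<alpha>"
  using tendsto_endpoints[OF assms(1)[unfolded sums_def] assms(2,3)]
  by (simp_all add: sums_def endpoints_sum[OF assms(2,3)])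

section \<open>Comparison of Abel and Cesaro means of real sequences\<close>

text \<open>
  Summation by parts in the form of a shift: \<open>a\<^sub>n x\<^sup>n\<close> is the difference of \<open>A\<^sub>n x\<^sup>n\<close> and
  \<open>x\<close> times its predecessor, where \<open>A\<close> denotes the partial sums.
\<close>

lemma power_series_partial_sums:
  fixes a :: "nat \<Rightarrow> real"
  assumes "(\<lambda>n. x ^ n * (\<Sum>k=0..n. a k)) sums T"
  shows "(\<lambda>n. x ^ n * a n) sums ((1 - x) * T)"
proof -
  let ?f = "\<lambda>n. x ^ n * (\<Sum>k=0..n. a k)"
  have "(\<lambda>n. ?f (Suc n)) sums (T - ?f 0)"
    using assms by (subst sums_Suc_iff) simp
  from sums_diff[OF this sums_mult[OF assms, of x]]
  have "(\<lambda>n. x ^ Suc n * a (Suc n)) sums ((1 - x) * T - x ^ 0 * a 0)"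
    by (simp add: algebra_simps)
  then show ?thesis by (subst (asm) sums_Suc_iff) simp
qed

lemma summable_linear_growth:
  fixes d :: "nat \<Rightarrow> real"
  assumes "\<And>n. \<bar>d n\<bar> \<le> K" "0 < x" "x < 1"
  shows "summable (\<lambda>n. real (Suc n) * x ^ n * d n)"
proof (rule summable_comparison_test')
  have "summable (\<lambda>n. real (Suc n) * x ^ n)"
    using geometric_deriv_sums[of x] assms(2,3) by (auto simp: sums_iff)
  then show "summable (\<lambda>n. real (Suc n) * x ^ n * K)" by (rule summable_mult2)
  show "norm (real (Suc n) * x ^ n * d n) \<le> real (Suc n) * x ^ n * K" for n
    using mult_left_mono[OF assms(1)[of n], of "real (Suc n) * x ^ n"] assms(2)
    by (simp add: abs_mult)
qed

lemma abel_mean_bound: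
  fixes a :: "nat \<Rightarrow> real"
  assumes d: "\<And>n. \<bar>1 / (real n + 1) * (\<Sum>k=0..n. a k) - l\<bar> \<le> d n" "\<And>n. d n \<le> K"
    and x: "0 < x" "x < 1"
    and S: "(\<lambda>n. x ^ n * a n) sums S"
  shows "\<bar>(1 - x) * S - l\<bar> \<le> (1 - x)\<^sup>2 * (\<Sum>n. real (Suc n) * x ^ n * d n)"
proof -
  define e where "e n = 1 / (real n + 1) * (\<Sum>k=0..n. a k) - l" for n
  have bounds: "\<bar>e n\<bar> \<le> d n" "\<bar>e n\<bar> \<le> K" "\<bar>d n\<bar> \<le> K" for n
    using d[of n] by (auto simp: e_def)
  have summ: "summable (\<lambda>n. real (Suc n) * x ^ n * e n)"
    "summable (\<lambda>n. real (Suc n) * x ^ n * d n)"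
    "summable (\<lambda>n. real (Suc n) * x ^ n * \<bar>e n\<bar>)"
    using bounds x by (intro summable_linear_growth[where K = K]; simp)+
  define E where "E = (\<Sum>n. real (Suc n) * x ^ n * e n)"
  have geo: "(\<lambda>n. real (Suc n) * x ^ n) sums (1 / (1 - x)\<^sup>2)"
    using geometric_deriv_sums[of x] x by simp
  have "(\<lambda>n. real (Suc n) * x ^ n * e n + real (Suc n) * x ^ n * l) sums (E + 1 / (1 - x)\<^sup>2 * l)"
    unfolding E_def by (intro sums_add sums_mult2 geo summable_sums summ)
  also have "(\<lambda>n. real (Suc n) * x ^ n * e n + real (Suc n) * x ^ n * l)
      = (\<lambda>n. x ^ n * (\<Sum>k=0..n. a k))"
    by (rule ext) (simp add: e_def field_simps)
  finally have "(\<lambda>n. x ^ n * a n) sums ((1 - x) * (E + 1 / (1 - x)\<^sup>2 * l))"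
    by (rule power_series_partial_sums)
  then have "S = (1 - x) * (E + 1 / (1 - x)\<^sup>2 * l)" using S by (metis sums_unique2)
  then have "(1 - x) * S = (1 - x)\<^sup>2 * (E + 1 / (1 - x)\<^sup>2 * l)"
    by (simp add: power2_eq_square)
  also have "\<dots> = (1 - x)\<^sup>2 * E + l"
    using x by (simp add: distrib_left)
  finally have "(1 - x) * S - l = (1 - x)\<^sup>2 * E" by simp
  moreover have "\<bar>E\<bar> \<le> (\<Sum>n. real (Suc n) * x ^ n * d n)"
  proof -
    have "\<bar>E\<bar> \<le> (\<Sum>n. \<bar>real (Suc n) * x ^ n * e n\<bar>)"
      unfolding E_def using summ(3) x by (intro summable_rabs) (simp add: abs_mult)
    also have "\<dots> = (\<Sum>n. real (Suc n) * x ^ n * \<bar>e n\<bar>)" using x by (simp add: abs_mult)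
    also have "\<dots> \<le> (\<Sum>n. real (Suc n) * x ^ n * d n)"
      using bounds x by (intro suminf_le summ mult_left_mono) auto
    finally show ?thesis .
  qed
  ultimately show ?thesis by (simp add: abs_mult mult_left_mono)
qed

text \<open>
  Up to \<open>\<epsilon>\<close>, only finitely many terms of a null sequence matter; they contribute at
  most a constant, which the factor \<open>(1 - x)\<^sup>2\<close> removes in the limit.
\<close>

lemma weighted_mean_null:
  fixes d :: "nat \<Rightarrow> real"
  assumes d: "d \<longlonglongrightarrow> 0" and nonneg: "\<And>n. 0 \<le> d n"
  shows "((\<lambda>x. (1 - x)\<^sup>2 * (\<Sum>n. real (Suc n) * x ^ n * d n)) \<longlongrightarrow> 0) (at_left 1)"
proof (rule tendstoI)
  fix e :: real assume e: "e > 0"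
  obtain K where K: "\<And>n. \<bar>d n\<bar> \<le> K"
    using convergent_imp_Bseq[of d] d unfolding convergent_def Bseq_def by auto
  have "\<forall>\<^sub>F n in sequentially. d n < e / 2" using e by (intro order_tendstoD(2)[OF d]) simp
  then obtain N where N: "\<And>n. n \<ge> N \<Longrightarrow> d n < e / 2" unfolding eventually_sequentially by blast
  define C where "C = (\<Sum>n<N. real (Suc n) * d n)"
  have main: "(1 - x)\<^sup>2 * (\<Sum>n. real (Suc n) * x ^ n * d n) \<le> e / 2 + (1 - x)\<^sup>2 * C"
    if x: "0 < x" "x < 1" for x
  proof -
    let ?h = "\<lambda>n. real (Suc n) * x ^ n * (e / 2) + (if n < N then real (Suc n) * d n else 0)"
    have h: "?h sums (1 / (1 - x)\<^sup>2 * (e / 2) + C)"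
      unfolding C_def using geometric_deriv_sums[of x] x
        sums_If_finite_set[of "{..<N}" "\<lambda>n. real (Suc n) * d n"]
      by (intro sums_add sums_mult2) simp_all
    have "(\<Sum>n. real (Suc n) * x ^ n * d n) \<le> suminf ?h"
    proof (rule suminf_le)
      show "summable (\<lambda>n. real (Suc n) * x ^ n * d n)"
        using K x by (rule summable_linear_growth)
      show "summable ?h" using h by (rule sums_summable)
      show "real (Suc n) * x ^ n * d n \<le> ?h n" for n
      proof (cases "n < N")
        case True
        have "real (Suc n) * x ^ n * d n \<le> real (Suc n) * 1 * d n"
          using x nonneg by (intro mult_right_mono mult_left_mono power_le_one) auto
        moreover have "0 \<le> real (Suc n) * x ^ n * (e / 2)" using x e by simp
        ultimately have "real (Suc n) * x ^ n * d n
            \<le> real (Suc n) * x ^ n * (e / 2) + real (Suc n) * d n"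
          by linarith
        then show ?thesis by (simp only: True if_True)
      next
        case False
        then show ?thesis using N[of n] x by (auto intro!: mult_left_mono)
      qed
    qed
    also have "\<dots> = 1 / (1 - x)\<^sup>2 * (e / 2) + C" using h by (rule sums_unique[symmetric])
    finally have "(1 - x)\<^sup>2 * (\<Sum>n. real (Suc n) * x ^ n * d n)
        \<le> (1 - x)\<^sup>2 * (1 / (1 - x)\<^sup>2 * (e / 2) + C)"
      by (rule mult_left_mono) simp
    also have "\<dots> = e / 2 + (1 - x)\<^sup>2 * C" using x by (simp add: field_simps)
    finally show ?thesis .
  qed
  have "((\<lambda>x. e / 2 + (1 - x)\<^sup>2 * C) \<longlongrightarrow> e / 2 + (1 - 1)\<^sup>2 * C) (at_left 1)"
    by (intro tendsto_intros)
  then have "\<forall>\<^sub>F x in at_left 1. e / 2 + (1 - x)\<^sup>2 * C < e"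
    by (rule order_tendstoD(2)) (use e in simp)
  with eventually_at_left_01[of 1, OF zero_less_one]
  show "\<forall>\<^sub>F x in at_left 1. dist ((1 - x)\<^sup>2 * (\<Sum>n. real (Suc n) * x ^ n * d n)) 0 < e"
  proof eventually_elim
    case (elim x)
    have "0 \<le> (\<Sum>n. real (Suc n) * x ^ n * d n)"
      using elim(1) nonneg by (intro suminf_nonneg summable_linear_growth[where K = K] K) auto
    then show ?case using main[of x] elim by (simp add: dist_real_def)
  qed
qed

section \<open>Cesaro summability implies Abel summability\<close>

text \<open>
  Subtraction is not available for fuzzy numbers, so the usual \<open>u\<^sub>n = S\<^sub>n - S\<^sub>n\<^sub>-\<^sub>1\<close> has to be
  read on the endpoints.
\<close>

lemma cesaro_bounded_imp_linear_growth:
  fixes u :: "nat \<Rightarrow> fuzzy_number"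
  assumes M: "\<And>n. dist ((1 / (real n + 1)) *\<^sub>R (\<Sum>k=0..n. u k)) 0 \<le> M"
  shows "dist (u n) 0 \<le> real (Suc n) * (2 * M)"
proof -
  have "0 \<le> M" using M[of 0] zero_le_dist order_trans by blast
  have real_case: "\<bar>a n\<bar> \<le> real (Suc n) * (2 * M)"
    if a: "\<And>n. \<bar>1 / (real n + 1) * (\<Sum>k=0..n. a k)\<bar> \<le> M" for a :: "nat \<Rightarrow> real"
  proof -
    have A: "\<bar>\<Sum>k=0..n. a k\<bar> \<le> real (Suc n) * M" for n
      using a[of n] by (simp add: abs_mult field_simps)
    show ?thesis
    proof (cases n)
      case 0
      then show ?thesis using A[of 0] \<open>0 \<le> M\<close> by simp
    next
      case (Suc m)
      then show ?thesis using A[of m] A[of n] \<open>0 \<le> M\<close> by (simp add: algebra_simps)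
    qed
  qed
  show ?thesis
  proof (rule dist_fuzzy_number_le)
    fix \<alpha> :: real assume \<alpha>: "0 \<le> \<alpha>" "\<alpha> \<le> 1"
    show "\<bar>lower (u n) \<alpha> - lower 0 \<alpha>\<bar> \<le> real (Suc n) * (2 * M)"
      and "\<bar>upper (u n) \<alpha> - upper 0 \<alpha>\<bar> \<le> real (Suc n) * (2 * M)"
      using real_case[of "\<lambda>n. lower (u n) \<alpha>"] real_case[of "\<lambda>n. upper (u n) \<alpha>"]
        order_trans[OF endpoint_le_dist_fuzzy_number(1)[OF \<alpha>] M]
        order_trans[OF endpoint_le_dist_fuzzy_number(2)[OF \<alpha>] M]
      by (simp_all add: endpoints_zero[OF \<alpha>] endpoints_scaleR[OF \<alpha>] endpoints_sum[OF \<alpha>])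
  qed
qed

theorem theorem3p3:
  fixes u :: "nat \<Rightarrow> fuzzy_number" and \<mu> :: fuzzy_number
  assumes "cesaro_summable_to u \<mu>"
  shows "abel_summable_to u \<mu>"
proof -
  define \<sigma> where "\<sigma> n = (1 / (real n + 1)) *\<^sub>R (\<Sum>k=0..n. u k)" for n
  define d where "d n = dist (\<sigma> n) \<mu>" for n
  have "\<sigma> \<longlonglongrightarrow> \<mu>" using assms unfolding cesaro_summable_to_def \<sigma>_def .
  then have d0: "d \<longlonglongrightarrow> 0" unfolding d_def by (rule tendsto_dist_iff[THEN iffD1])
  then obtain K where K: "\<And>n. d n \<le> K"
    using convergent_imp_Bseq[of d] unfolding convergent_def Bseq_def by (auto simp: abs_le_iff)
  have "dist (\<sigma> n) 0 \<le> K + dist \<mu> 0" for n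
    using dist_triangle[of "\<sigma> n" 0 \<mu>] K[of n] by (simp add: d_def)
  then have growth: "dist (u n) 0 \<le> real (Suc n) * (2 * (K + dist \<mu> 0))" for n
    unfolding \<sigma>_def by (rule cesaro_bounded_imp_linear_growth)
  have summ: "summable (\<lambda>n. x ^ n *\<^sub>R u n)" if x: "0 < x" "x < 1" for x
  proof (rule summable_fuzzy_number_comparison)
    show "summable (\<lambda>n. real (Suc n) * x ^ n * (2 * (K + dist \<mu> 0)))"
      using x by (intro summable_linear_growth[OF order_refl])
    show "dist (x ^ n *\<^sub>R u n) 0 \<le> real (Suc n) * x ^ n * (2 * (K + dist \<mu> 0))" for n
    proof -
      have "dist (x ^ n *\<^sub>R u n) 0 \<le> x ^ n * dist (u n) 0"
        using x by (intro dist_scaleR_0_fuzzy_number) simp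
      also have "\<dots> \<le> x ^ n * (real (Suc n) * (2 * (K + dist \<mu> 0)))"
        using x by (intro mult_left_mono growth) simp
      finally show ?thesis by (simp only: mult_ac)
    qed
  qed
  have bound: "dist ((1 - x) *\<^sub>R (\<Sum>n. x ^ n *\<^sub>R u n)) \<mu>
      \<le> (1 - x)\<^sup>2 * (\<Sum>n. real (Suc n) * x ^ n * d n)" if x: "0 < x" "x < 1" for x
  proof (rule dist_fuzzy_number_le)
    fix \<alpha> :: real assume \<alpha>: "0 \<le> \<alpha>" "\<alpha> \<le> 1"
    note ends = endpoints_scaleR[OF \<alpha>] endpoints_sum[OF \<alpha>]
    note sums = sums_endpoints[OF summable_sums[OF summ[OF x]] \<alpha>]
    have close: "\<bar>lower (\<sigma> n) \<alpha> - lower \<mu> \<alpha>\<bar> \<le> d n" "\<bar>upper (\<sigma> n) \<alpha> - upper \<mu> \<alpha>\<bar> \<le> d n" for n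
      unfolding d_def by (rule endpoint_le_dist_fuzzy_number[OF \<alpha>])+
    show "\<bar>lower ((1 - x) *\<^sub>R (\<Sum>n. x ^ n *\<^sub>R u n)) \<alpha> - lower \<mu> \<alpha>\<bar>
        \<le> (1 - x)\<^sup>2 * (\<Sum>n. real (Suc n) * x ^ n * d n)"
      using abel_mean_bound[OF _ K x, of "\<lambda>n. lower (u n) \<alpha>" "lower \<mu> \<alpha>"] sums(1) close(1) x
      by (simp add: ends \<sigma>_def)
    show "\<bar>upper ((1 - x) *\<^sub>R (\<Sum>n. x ^ n *\<^sub>R u n)) \<alpha> - upper \<mu> \<alpha>\<bar>
        \<le> (1 - x)\<^sup>2 * (\<Sum>n. real (Suc n) * x ^ n * d n)"
      using abel_mean_bound[OF _ K x, of "\<lambda>n. upper (u n) \<alpha>" "upper \<mu> \<alpha>"] sums(2) close(2) x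
      by (simp add: ends \<sigma>_def)
  qed
  have "((\<lambda>x. (1 - x) *\<^sub>R (\<Sum>n. x ^ n *\<^sub>R u n)) \<longlongrightarrow> \<mu>) (at_left 1)"
  proof (rule metric_tendsto_imp_tendsto[OF weighted_mean_null[OF d0]])
    show "\<forall>\<^sub>F x in at_left 1. dist ((1 - x) *\<^sub>R (\<Sum>n. x ^ n *\<^sub>R u n)) \<mu>
        \<le> dist ((1 - x)\<^sup>2 * (\<Sum>n. real (Suc n) * x ^ n * d n)) 0"
      using eventually_at_left_01[of 1, OF zero_less_one]
      by eventually_elim (use bound in \<open>force simp: dist_real_def\<close>)
  qed (simp add: d_def)
  with summ show ?thesis unfolding abel_summable_to_def by auto
qed

end
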